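(* Let $S^1 = \{z \in \mathbb{C} : |z| = 1\}$ be the circle group under multiplication, with its usual topology. There are no continuous inverse ambiguous functions $f : S^1 \to S^1$.
   Context: For a group $G$, a function $f : G \to G$ is called inverse ambiguous if it is bijective and its inverse function satisfies $f^{-1}(x) = (f(x))^{-1}$ for all $x \in G$, where the right-hand side is the group inverse of $f(x)$. Equivalently, $f(f(x)) = x^{-1}$ for all $x \in G$. *)

theory Defs
  imports "HOL-Analysis.Analysis" "HOL-Algebra.Group"
begin

definition inverse_ambiguous :: "('a, 'b) monoid_scheme \<Rightarrow> ('a \<Rightarrow> 'a) \<Rightarrow> bool" where
  "inverse_ambiguous G f \<longleftrightarrow>
     bij_betw f (carrier G) (carrier G) \<and>
     (\<forall>x\<in>carrier G. inv_into (carrier G) f x = inv\<^bsub>G\<^esub> (f x))"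

definition circle_group :: "complex monoid" where
  "circle_group = \<lparr>carrier = {z. cmod z = 1}, monoid.mult = (*), one = 1\<rparr>"

lemma group_circle_group: "group circle_group"
proof (rule groupI)
  fix x assume "x \<in> carrier circle_group"
  then have "inverse x \<in> carrier circle_group"
    "inverse x \<otimes>\<^bsub>circle_group\<^esub> x = \<one>\<^bsub>circle_group\<^esub>"
    by (auto simp: circle_group_def norm_inverse intro!: left_inverse)
  then show "\<exists>y\<in>carrier circle_group. y \<otimes>\<^bsub>circle_group\<^esub> x = \<one>\<^bsub>circle_group\<^esub>"
    by blast
qed (auto simp: circle_group_def norm_mult)

lemma inv_circle_group:
  assumes "x \<in> carrier circle_group"
  shows "inv\<^bsub>circle_group\<^esub> x = inverse x"
  by (rule group.inv_equality[OF group_circle_group])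
    (use assms in \<open>auto simp: circle_group_def norm_inverse intro!: left_inverse\<close>)

lemma inverse_ambiguous_iff:
  assumes "group G" and "f \<in> carrier G \<rightarrow> carrier G"
  shows "inverse_ambiguous G f \<longleftrightarrow> (\<forall>x\<in>carrier G. f (f x) = inv\<^bsub>G\<^esub> x)"
proof
  assume ia: "inverse_ambiguous G f"
  then have bij: "bij_betw f (carrier G) (carrier G)"
    and eq: "\<And>x. x \<in> carrier G \<Longrightarrow> inv_into (carrier G) f x = inv\<^bsub>G\<^esub> (f x)"
    by (auto simp: inverse_ambiguous_def)
  show "\<forall>x\<in>carrier G. f (f x) = inv\<^bsub>G\<^esub> x"
  proof
    fix x assume x: "x \<in> carrier G"
    with assms(2) have "f x \<in> carrier G" "f (f x) \<in> carrier G" by auto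
    moreover from x have "inv_into (carrier G) f (f x) = x"
      using bij by (simp add: bij_betw_inv_into_left)
    ultimately have "x = inv\<^bsub>G\<^esub> (f (f x))"
      using eq[of "f x"] by simp
    with \<open>f (f x) \<in> carrier G\<close> show "f (f x) = inv\<^bsub>G\<^esub> x"
      using group.inv_inv[OF assms(1)] by metis
  qed
next
  assume ff: "\<forall>x\<in>carrier G. f (f x) = inv\<^bsub>G\<^esub> x"
  interpret group G by fact
  have fc: "f x \<in> carrier G" if "x \<in> carrier G" for x
    using assms(2) that by auto
  have f_inv: "f (inv\<^bsub>G\<^esub> (f x)) = x" if "x \<in> carrier G" for x
    by (metis ff fc inv_inv that)
  have inj: "inj_on f (carrier G)"
    by (rule inj_onI) (metis ff inv_inv)
  have "f ` carrier G = carrier G"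
  proof
    show "carrier G \<subseteq> f ` carrier G"
      using fc f_inv by (metis image_eqI inv_closed subsetI)
  qed (use fc in auto)
  with inj show "inverse_ambiguous G f"
    unfolding inverse_ambiguous_def bij_betw_def
    using inv_into_f_eq[OF inj _ f_inv] fc by auto
qed

end

theory Submission
  imports Defs
begin

text \<open>
  A continuous \<open>f\<close> on the circle lifts to a continuous \<open>g\<close> on the line, and \<open>f (f z) = inverse z\<close>
  becomes \<open>g (g t) = c - t\<close> for a constant \<open>c\<close>. Hence \<open>g\<close> is injective, so strictly monotone;
  its square is then strictly increasing, whereas \<open>t \<mapsto> c - t\<close> is strictly decreasing.
\<close>

lemma continuous_square_not_reflection:
  fixes g :: "real \<Rightarrow> real"
  assumes cont: "continuous_on UNIV g"
  shows "\<exists>t. g (g t) \<noteq> c - t"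
proof (rule ccontr)
  assume "\<nexists>t. g (g t) \<noteq> c - t"
  then have gg: "g (g t) = c - t" for t by blast
  \<comment> \<open>Equal values of \<open>g\<close> stay equal after a second application of
    \<open>g\<close>, and \<open>c - t\<close> determines \<open>t\<close>.\<close>
  have "inj g"
    by (rule injI) (metis gg diff_left_imp_eq)
  then consider "strict_mono_on UNIV g" | "strict_antimono_on UNIV g"
    using injective_eq_monotone_map[of UNIV g] cont by auto
  \<comment> \<open>If \<open>g\<close> reverses order, applying it twice restores it, so both cases
    agree.\<close>
  then have "g (g 0) < g (g 1)"
  proof cases
    case 1
    then show ?thesis by (simp add: monotone_on_def)
  next
    case 2
    then show ?thesis by (simp add: monotone_on_def)
  qed
  then show False by (simp add: gg)
qed

text \<open>Distinct integers are at least 1 apart, so \<open>h\<close> has a discrete range, and a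
  continuous image of a connected set cannot jump.\<close>

lemma continuous_on_Ints_constant:
  fixes h :: "'a::topological_space \<Rightarrow> real"
  assumes "connected S" "continuous_on S h" "\<And>x. x \<in> S \<Longrightarrow> h x \<in> \<int>"
  shows "h constant_on S"
proof (rule continuous_discrete_range_constant[OF assms(1,2)])
  fix x assume "x \<in> S"
  then have "1 \<le> norm (h y - h x)" if "y \<in> S" "h y \<noteq> h x" for y
    using that assms(3) Ints_nonzero_abs_ge1[of "h y - h x"] by auto
  then show "\<exists>e>0. \<forall>y. y \<in> S \<and> h y \<noteq> h x \<longrightarrow> e \<le> norm (h y - h x)"
    using zero_less_one by blast
qed

text \<open>The map \<open>t\<close> to \<open>f (cis t)\<close> has no zeros and lives on the
  contractible line, so it has a continuous logarithm \<open>h\<close>. Its values have modulus 1,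
  so \<open>h\<close> is purely imaginary and \<open>Im h\<close> is the lift.\<close>

lemma circle_map_lift:
  fixes f :: "complex \<Rightarrow> complex"
  assumes cont: "continuous_on (sphere 0 1) f" and f: "f \<in> sphere 0 1 \<rightarrow> sphere 0 1"
  obtains g :: "real \<Rightarrow> real" where "continuous_on UNIV g" "\<And>t. f (cis t) = cis (g t)"
proof -
  have norm: "norm (f (cis t)) = 1" for t
    using f by (auto simp: Pi_iff)
  have "continuous_on UNIV (\<lambda>t. f (cis t))"
    by (rule continuous_on_compose2[OF cont]) (auto intro!: continuous_intros)
  moreover have "contractible (UNIV :: real set)"
    by (simp add: convex_imp_contractible)
  moreover have "f (cis t) \<noteq> 0" for t
    using norm[of t] by auto
  ultimately obtain h where h: "continuous_on UNIV h" "\<And>t. f (cis t) = exp (h t)"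
    using continuous_logarithm_on_contractible[of UNIV "\<lambda>t. f (cis t)"] by auto
  show thesis
  proof
    show "continuous_on UNIV (\<lambda>t. Im (h t))"
      by (intro continuous_intros h)
    have "Re (h t) = 0" for t
      using norm[of t] h(2) by simp
    then show "f (cis t) = cis (Im (h t))" for t
      by (simp add: h(2) exp_eq_polar)
  qed
qed

lemma cis_eq_1_imp_Ints:
  assumes "cis t = 1"
  shows "t / (2 * pi) \<in> \<int>"
proof -
  obtain n :: int where "t = of_int (2 * n) * pi"
    using assms exp_eq_1[of "\<i> * of_real t"] by (auto simp: cis_conv_exp)
  then show ?thesis by simp
qed

theorem lemma2p1:
  shows "\<not> (\<exists>f :: complex \<Rightarrow> complex.
           continuous_on (carrier circle_group) f \<and> inverse_ambiguous circle_group f)"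
proof
  assume "\<exists>f :: complex \<Rightarrow> complex.
    continuous_on (carrier circle_group) f \<and> inverse_ambiguous circle_group f"
  then obtain f where cont: "continuous_on (carrier circle_group) f"
    and ia: "inverse_ambiguous circle_group f" by blast
  have S: "carrier circle_group = sphere 0 1"
    by (auto simp: circle_group_def)
  have f: "f \<in> carrier circle_group \<rightarrow> carrier circle_group"
    using ia by (auto simp: inverse_ambiguous_def bij_betw_def)
  have ff: "f (f (cis t)) = cis (- t)" for t
    using ia inverse_ambiguous_iff[OF group_circle_group f]
    by (simp add: S inv_circle_group cis_inverse)
  obtain g where g: "continuous_on UNIV g" "\<And>t. f (cis t) = cis (g t)"
    using circle_map_lift cont f unfolding S by blast
  \<comment> \<open>The lifting equation is used twice, at \<open>t\<close> and at
    \<open>g t\<close>.\<close>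
  have "cis (g (g t)) = cis (- t)" for t
    using ff[of t] by (simp add: g(2))
  then have "cis (g (g t) + t) = 1" for t
    by (metis cis_mult cis_zero add.left_inverse)
  \<comment> \<open>So far the integer may vary with \<open>t\<close>; continuity on the connected
    line makes it a single \<open>k\<close>, which gives the reflection with
    \<open>c = 2 * pi * k\<close>.\<close>
  then have "(g (g t) + t) / (2 * pi) \<in> \<int>" for t
    by (rule cis_eq_1_imp_Ints)
  moreover have "continuous_on UNIV (\<lambda>t. (g (g t) + t) / (2 * pi))"
    by (intro continuous_intros continuous_on_compose2[OF g(1) g(1)]) auto
  ultimately have "(\<lambda>t. (g (g t) + t) / (2 * pi)) constant_on UNIV"
    by (intro continuous_on_Ints_constant) auto
  then obtain k where "(g (g t) + t) / (2 * pi) = k" for t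
    by (auto simp: constant_on_def)
  then have "g (g t) = 2 * pi * k - t" for t
    by (simp add: field_simps)
  then show False
    using continuous_square_not_reflection[OF g(1)] by blast
qed

end
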